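(* Let $n\ge3$, let $t$ be an indeterminate, let $f(t)$ be an invertible element of $\mathbb{Z}[t^{\pm1}]$, and let $\eta_2':VST_n\to\mathrm{GL}_n(\mathbb{Z}[t^{\pm1}])$ be a homogeneous $2$-local representation of the virtual singular twin group $VST_n$ that extends the representation $\eta_2:T_n\to\mathrm{GL}_n(\mathbb{Z}[t^{\pm1}])$ (associated with $f(t)$) of the twin group. Then there are $w(t),y(t),v(t)\in\mathbb{Z}[t^{\pm1}]$, with $v(t)$ invertible in $\mathbb{Z}[t^{\pm1}]$, such that for all $1\le i\le n-1$, $$\eta_2'(s_i)=\begin{pmatrix} I_{i-1}&0&0&0\\0&0&f(t)&0\\0&\frac1{f(t)}&0&0\\0&0&0&I_{n-i-1}\end{pmatrix},\qquad \eta_2'(\tau_i)=\begin{pmatrix} I_{i-1}&0&0&0\\0&w(t)&f^2(t)y(t)&0\\0&y(t)&w(t)&0\\0&0&0&I_{n-i-1}\end{pmatrix},$$ $$\eta_2'(\nu_i)=\begin{pmatrix} I_{i-1}&0&0&0\\0&0&v(t)&0\\0&\frac{1}{v(t)}&0&0\\0&0&0&I_{n-i-1}\end{pmatrix}.$$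
   Context: The virtual singular twin group $VST_n$ is the group generated by $s_i,\tau_i,\nu_i$ ($1\le i\le n-1$) subject to: $s_i^2=1$, $\nu_i^2=1$ and $\tau_is_i=s_i\tau_i$ for all $i$; $s_is_j\tau_i=\tau_js_is_j$, $\nu_i\nu_j\nu_i=\nu_j\nu_i\nu_j$, $\nu_is_j\nu_i=\nu_js_i\nu_j$, $\nu_i\tau_j\nu_i=\nu_j\tau_i\nu_j$ for $|i-j|=1$; and $g_ih_j=h_jg_i$ for $|i-j|\ge 2$, where $g_i,h_i\in\{s_i,\tau_i,\nu_i\}$. The twin group $T_n$ is the group generated by $s_1,\dots,s_{n-1}$ with relations $s_i^2=1$ for all $i$ and $s_is_j=s_js_i$ for $|i-j|\ge2$. For an invertible $f(t)\in\mathbb{Z}[t^{\pm1}]$, the representation $\eta_2:T_n\to\mathrm{GL}_n(\mathbb{Z}[t^{\pm1}])$ is defined by letting $\eta_2(s_i)$ be the block diagonal matrix with diagonal blocks $I_{i-1}$, $\begin{pmatrix}0&f(t)\\1/f(t)&0\end{pmatrix}$, $I_{n-i-1}$. A representation $\theta:VST_n\to \mathrm{GL}_n(\mathbb{Z}[t^{\pm1}])$ is homogeneous $2$-local if there are $2\times2$ invertible matrices $S,T,V$ over $\mathbb{Z}[t^{\pm1}]$, independent of $i$, such that for all $1\le i\le n-1$ the matrices $\theta(s_i),\theta(\tau_i),\theta(\nu_i)$ are block diagonal with diagonal blocks $(I_{i-1},S,I_{n-i-1})$, $(I_{i-1},T,I_{n-i-1})$, $(I_{i-1},V,I_{n-i-1})$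 respectively. It extends $\eta_2$ if $\theta(s_i)=\eta_2(s_i)$ for all $i$. $I_r$ is the $r\times r$ identity matrix. *)

theory Defs
  imports "HOL-Library.Poly_Mapping" "HOL-Algebra.Coset" "Jordan_Normal_Form.Matrix"
begin

section \<open>Groups given by generators and relations\<close>

text \<open>A letter \<open>(g, True)\<close> stands for the generator \<open>g\<close>, and \<open>(g, False)\<close> for its formal inverse.\<close>

type_synonym 'g word = "('g \<times> bool) list"

definition pos :: "'g list \<Rightarrow> 'g word" where
  "pos gs = map (\<lambda>g. (g, True)) gs"

definition words :: "'g set \<Rightarrow> 'g word set" where
  "words X = lists (X \<times> UNIV)"

text \<open>\<open>word_cong X R\<close> is the smallest congruence on the words over \<open>X\<close> which contains the
  pairs in \<open>R\<close> and cancels every letter against its inverse.\<close>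

inductive_set word_cong :: "'g set \<Rightarrow> ('g word \<times> 'g word) set \<Rightarrow> ('g word \<times> 'g word) set"
  for X :: "'g set" and R :: "('g word \<times> 'g word) set" where
  refl: "u \<in> words X \<Longrightarrow> (u, u) \<in> word_cong X R"
| sym: "(u, v) \<in> word_cong X R \<Longrightarrow> (v, u) \<in> word_cong X R"
| trans: "(u, v) \<in> word_cong X R \<Longrightarrow> (v, w) \<in> word_cong X R \<Longrightarrow> (u, w) \<in> word_cong X R"
| compat: "(u, v) \<in> word_cong X R \<Longrightarrow> a \<in> words X \<Longrightarrow> b \<in> words X \<Longrightarrow>
    (a @ u @ b, a @ v @ b) \<in> word_cong X R"
| cancel: "g \<in> X \<Longrightarrow> ([(g, e), (g, \<not> e)], []) \<in> word_cong X R"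
| relator: "(u, v) \<in> R \<Longrightarrow> u \<in> words X \<Longrightarrow> v \<in> words X \<Longrightarrow> (u, v) \<in> word_cong X R"

definition presented_group :: "'g set \<Rightarrow> ('g word \<times> 'g word) set \<Rightarrow> 'g word set monoid" where
  "presented_group X R =
    \<lparr>carrier = words X // word_cong X R,
     monoid.mult = (\<lambda>A B. \<Union>u\<in>A. \<Union>v\<in>B. word_cong X R `` {u @ v}),
     one = word_cong X R `` {[]}\<rparr>"

definition presented_gen :: "'g set \<Rightarrow> ('g word \<times> 'g word) set \<Rightarrow> 'g \<Rightarrow> 'g word set" where
  "presented_gen X R g = word_cong X R `` {pos [g]}"

primrec word_val :: "('a, 'b) monoid_scheme \<Rightarrow> ('g \<Rightarrow> 'a) \<Rightarrow> 'g word \<Rightarrow> 'a" where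
  "word_val G \<phi> [] = \<one>\<^bsub>G\<^esub>"
| "word_val G \<phi> (x # w) =
    (if snd x then \<phi> (fst x) else inv\<^bsub>G\<^esub> \<phi> (fst x)) \<otimes>\<^bsub>G\<^esub> word_val G \<phi> w"

text \<open>The homomorphism out of a presented group which is induced by an assignment \<open>\<phi>\<close> of the
  generators respecting the relations; see \<open>presented_lift_hom\<close> and \<open>presented_lift_gen\<close>.\<close>

definition presented_lift :: "('a, 'b) monoid_scheme \<Rightarrow> ('g \<Rightarrow> 'a) \<Rightarrow> 'g word set \<Rightarrow> 'a" where
  "presented_lift G \<phi> A = the_elem (word_val G \<phi> ` A)"

lemma words_simps [simp]:
  "[] \<in> words X" "x # u \<in> words X \<longleftrightarrow> fst x \<in> X \<and> u \<in> words X"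
  "u @ v \<in> words X \<longleftrightarrow> u \<in> words X \<and> v \<in> words X"
  by (auto simp: words_def mem_Times_iff)

lemma pos_simps [simp]: "pos [] = []" "pos (g # gs) = (g, True) # pos gs"
  by (auto simp: pos_def)

lemma word_cong_words: "(u, v) \<in> word_cong X R \<Longrightarrow> u \<in> words X \<and> v \<in> words X"
  by (induction rule: word_cong.induct) auto

lemma equiv_word_cong: "equiv (words X) (word_cong X R)"
  by (rule equivI)
    (auto simp: refl_on_def sym_def trans_def intro: word_cong.intros dest: word_cong_words)

lemma word_cong_append:
  assumes "(u, u') \<in> word_cong X R" "(v, v') \<in> word_cong X R"
  shows "(u @ v, u' @ v') \<in> word_cong X R"
proof -
  have "([] @ u @ v, [] @ u' @ v) \<in> word_cong X R"
    using assms word_cong_words by (intro word_cong.compat) auto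
  moreover have "(u' @ v @ [], u' @ v' @ []) \<in> word_cong X R"
    using assms word_cong_words by (intro word_cong.compat) auto
  ultimately show ?thesis by (auto intro: word_cong.trans)
qed

lemma word_cong_class_eq:
  "(u, v) \<in> word_cong X R \<Longrightarrow> word_cong X R `` {u} = word_cong X R `` {v}"
  by (rule equiv_class_eq[OF equiv_word_cong])

lemma presented_mult:
  assumes "u \<in> words X" "v \<in> words X"
  shows "word_cong X R `` {u} \<otimes>\<^bsub>presented_group X R\<^esub> word_cong X R `` {v} = word_cong X R `` {u @ v}"
proof -
  let ?U = "word_cong X R `` {u}" and ?V = "word_cong X R `` {v}"
  have eq: "word_cong X R `` {u' @ v'} = word_cong X R `` {u @ v}" if "u' \<in> ?U" "v' \<in> ?V" for u' v'
    using that by (intro word_cong_class_eq[symmetric] word_cong_append) simp_all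
  have "u \<in> ?U" "v \<in> ?V" using assms by (simp_all add: word_cong.refl)
  then have "?U \<noteq> {}" "?V \<noteq> {}" by blast+
  have "(\<Union>u'\<in>?U. \<Union>v'\<in>?V. word_cong X R `` {u' @ v'}) =
      (\<Union>u'\<in>?U. \<Union>v'\<in>?V. word_cong X R `` {u @ v})"
    by (intro SUP_cong HOL.refl eq)
  also have "\<dots> = word_cong X R `` {u @ v}"
    using \<open>?U \<noteq> {}\<close> \<open>?V \<noteq> {}\<close> by (simp only: UN_constant if_False)
  finally show ?thesis by (simp add: presented_group_def)
qed

lemma presented_carrierE:
  assumes "A \<in> carrier (presented_group X R)"
  obtains u where "u \<in> words X" "A = word_cong X R `` {u}"
  using assms by (auto simp: presented_group_def elim: quotientE)

lemma presented_carrierI: "u \<in> words X \<Longrightarrow> word_cong X R `` {u} \<in> carrier (presented_group X R)"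
  by (simp add: presented_group_def quotientI)

lemma presented_one: "\<one>\<^bsub>presented_group X R\<^esub> = word_cong X R `` {[]}"
  by (simp add: presented_group_def)

lemma word_left_inverse:
  "u \<in> words X \<Longrightarrow> \<exists>v\<in>words X. (v @ u, []) \<in> word_cong X R"
proof (induction u)
  case Nil
  then show ?case by (intro bexI[of _ "[]"]) (auto intro: word_cong.refl)
next
  case (Cons x u)
  then obtain v where v: "v \<in> words X" "(v @ u, []) \<in> word_cong X R" by auto
  obtain g e where x: "x = (g, e)" by (cases x)
  have g: "g \<in> X" using Cons.prems x by simp
  have "([(g, \<not> e), (g, \<not> \<not> e)], []) \<in> word_cong X R"
    using g by (rule word_cong.cancel)
  then have "(v @ [(g, \<not> e), (g, \<not> \<not> e)] @ u, v @ [] @ u) \<in> word_cong X R"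
    using v Cons.prems by (intro word_cong.compat) auto
  then have "((v @ [(g, \<not> e)]) @ x # u, []) \<in> word_cong X R"
    using v x by (auto intro: word_cong.trans)
  then show ?case using v g by (intro bexI[of _ "v @ [(g, \<not> e)]"]) auto
qed

lemma group_presented: "group (presented_group X R)"
proof (rule groupI)
  show "\<one>\<^bsub>presented_group X R\<^esub> \<in> carrier (presented_group X R)"
    unfolding presented_one by (intro presented_carrierI) simp
next
  fix A B assume "A \<in> carrier (presented_group X R)" "B \<in> carrier (presented_group X R)"
  then show "A \<otimes>\<^bsub>presented_group X R\<^esub> B \<in> carrier (presented_group X R)"
    by (elim presented_carrierE) (simp add: presented_mult presented_carrierI)
next
  fix A B C assume "A \<in> carrier (presented_group X R)" "B \<in> carrier (presented_group X R)"
    "C \<in> carrier (presented_group X R)"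
  then show "A \<otimes>\<^bsub>presented_group X R\<^esub> B \<otimes>\<^bsub>presented_group X R\<^esub> C =
      A \<otimes>\<^bsub>presented_group X R\<^esub> (B \<otimes>\<^bsub>presented_group X R\<^esub> C)"
    by (elim presented_carrierE) (simp add: presented_mult)
next
  fix A assume "A \<in> carrier (presented_group X R)"
  then show "\<one>\<^bsub>presented_group X R\<^esub> \<otimes>\<^bsub>presented_group X R\<^esub> A = A"
    by (elim presented_carrierE) (simp add: presented_mult presented_one)
next
  fix A assume "A \<in> carrier (presented_group X R)"
  then obtain u where u: "u \<in> words X" "A = word_cong X R `` {u}" by (rule presented_carrierE)
  obtain v where v: "v \<in> words X" "(v @ u, []) \<in> word_cong X R"
    using word_left_inverse[OF u(1)] by blast
  show "\<exists>B\<in>carrier (presented_group X R). B \<otimes>\<^bsub>presented_group X R\<^esub> A = \<one>\<^bsub>presented_group X R\<^esub>"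
    using u v by (intro bexI[of _ "word_cong X R `` {v}"])
      (auto simp: presented_mult presented_one presented_carrierI intro!: word_cong_class_eq
        simp del: Image_singleton_iff)
qed

context group
begin

lemma word_val_closed:
  assumes "\<phi> \<in> X \<rightarrow> carrier G" "u \<in> words X"
  shows "word_val G \<phi> u \<in> carrier G"
  using assms(2,1) by (induction u) (auto simp: Pi_iff)

lemma word_val_append:
  assumes "\<phi> \<in> X \<rightarrow> carrier G" "u \<in> words X" "v \<in> words X"
  shows "word_val G \<phi> (u @ v) = word_val G \<phi> u \<otimes> word_val G \<phi> v"
  using assms(2)
proof (induction u)
  case Nil
  then show ?case using word_val_closed[OF assms(1,3)] by simp
next
  case (Cons x u)
  have "\<phi> (fst x) \<in> carrier G" using Cons.prems assms(1) by auto
  then show ?case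
    using Cons word_val_closed[OF assms(1,3)] word_val_closed[OF assms(1), of u]
    by (simp add: m_assoc)
qed

lemma word_val_cong:
  assumes "\<phi> \<in> X \<rightarrow> carrier G"
    and "\<And>u v. (u, v) \<in> R \<Longrightarrow> word_val G \<phi> u = word_val G \<phi> v"
    and "(u, v) \<in> word_cong X R"
  shows "word_val G \<phi> u = word_val G \<phi> v"
  using assms(3)
proof (induction rule: word_cong.induct)
  case (compat u v a b)
  then have "u \<in> words X" "v \<in> words X" using word_cong_words by auto
  then show ?case using compat by (simp add: word_val_append[OF assms(1)])
next
  case (cancel g e)
  then show ?case using assms(1) by (cases e) (auto simp: Pi_iff)
qed (use assms(2) in auto)

lemma presented_lift_class:
  assumes "\<phi> \<in> X \<rightarrow> carrier G"
    and "\<And>u v. (u, v) \<in> R \<Longrightarrow> word_val G \<phi> u = word_val G \<phi> v"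
    and "u \<in> words X"
  shows "presented_lift G \<phi> (word_cong X R `` {u}) = word_val G \<phi> u"
proof -
  have "word_val G \<phi> ` (word_cong X R `` {u}) = {word_val G \<phi> u}"
    using word_val_cong[OF assms(1,2)] word_cong.refl[OF assms(3)] by (auto simp: image_iff)
  then show ?thesis by (simp add: presented_lift_def)
qed

lemma presented_lift_hom:
  assumes "\<phi> \<in> X \<rightarrow> carrier G"
    and "\<And>u v. (u, v) \<in> R \<Longrightarrow> word_val G \<phi> u = word_val G \<phi> v"
  shows "presented_lift G \<phi> \<in> hom (presented_group X R) G"
  by (rule homI; elim presented_carrierE)
    (simp_all add: presented_mult presented_lift_class[OF assms] word_val_append[OF assms(1)]
      word_val_closed[OF assms(1)])

lemma presented_lift_gen:
  assumes "\<phi> \<in> X \<rightarrow> carrier G"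
    and "\<And>u v. (u, v) \<in> R \<Longrightarrow> word_val G \<phi> u = word_val G \<phi> v"
    and "g \<in> X"
  shows "presented_lift G \<phi> (presented_gen X R g) = \<phi> g"
  using assms(1,3) unfolding presented_gen_def
  by (subst presented_lift_class[OF assms(1,2)]) (auto simp: Pi_iff)

end


section \<open>Twin groups and virtual singular twin groups\<close>

inductive_set twin_rels :: "nat \<Rightarrow> (nat word \<times> nat word) set" for n :: nat where
  "i \<in> {1..<n} \<Longrightarrow> (pos [i, i], []) \<in> twin_rels n"
| "i \<in> {1..<n} \<Longrightarrow> j \<in> {1..<n} \<Longrightarrow> \<bar>int i - int j\<bar> \<ge> 2 \<Longrightarrow>
    (pos [i, j], pos [j, i]) \<in> twin_rels n"

definition twin_group :: "nat \<Rightarrow> nat word set monoid" where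
  "twin_group n = presented_group {1..<n} (twin_rels n)"

definition twin_gen :: "nat \<Rightarrow> nat \<Rightarrow> nat word set" where
  "twin_gen n = presented_gen {1..<n} (twin_rels n)"

datatype vst_letter = Sig nat | Tau nat | Nu nat

definition vst_letters :: "nat \<Rightarrow> vst_letter set" where
  "vst_letters n = Sig ` {1..<n} \<union> Tau ` {1..<n} \<union> Nu ` {1..<n}"

inductive_set vst_rels :: "nat \<Rightarrow> (vst_letter word \<times> vst_letter word) set" for n :: nat where
  "i \<in> {1..<n} \<Longrightarrow> (pos [Sig i, Sig i], []) \<in> vst_rels n"
| "i \<in> {1..<n} \<Longrightarrow> (pos [Nu i, Nu i], []) \<in> vst_rels n"
| "i \<in> {1..<n} \<Longrightarrow> (pos [Tau i, Sig i], pos [Sig i, Tau i]) \<in> vst_rels n"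
| "i \<in> {1..<n} \<Longrightarrow> j \<in> {1..<n} \<Longrightarrow> \<bar>int i - int j\<bar> = 1 \<Longrightarrow>
    (pos [Sig i, Sig j, Tau i], pos [Tau j, Sig i, Sig j]) \<in> vst_rels n"
| "i \<in> {1..<n} \<Longrightarrow> j \<in> {1..<n} \<Longrightarrow> \<bar>int i - int j\<bar> = 1 \<Longrightarrow>
    (pos [Nu i, Nu j, Nu i], pos [Nu j, Nu i, Nu j]) \<in> vst_rels n"
| "i \<in> {1..<n} \<Longrightarrow> j \<in> {1..<n} \<Longrightarrow> \<bar>int i - int j\<bar> = 1 \<Longrightarrow>
    (pos [Nu i, Sig j, Nu i], pos [Nu j, Sig i, Nu j]) \<in> vst_rels n"
| "i \<in> {1..<n} \<Longrightarrow> j \<in> {1..<n} \<Longrightarrow> \<bar>int i - int j\<bar> = 1 \<Longrightarrow>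
    (pos [Nu i, Tau j, Nu i], pos [Nu j, Tau i, Nu j]) \<in> vst_rels n"
| "i \<in> {1..<n} \<Longrightarrow> j \<in> {1..<n} \<Longrightarrow> \<bar>int i - int j\<bar> \<ge> 2 \<Longrightarrow>
    g \<in> {Sig, Tau, Nu} \<Longrightarrow> h \<in> {Sig, Tau, Nu} \<Longrightarrow>
    (pos [g i, h j], pos [h j, g i]) \<in> vst_rels n"

definition VST :: "nat \<Rightarrow> vst_letter word set monoid" where
  "VST n = presented_group (vst_letters n) (vst_rels n)"

definition vst_gen :: "nat \<Rightarrow> vst_letter \<Rightarrow> vst_letter word set" where
  "vst_gen n = presented_gen (vst_letters n) (vst_rels n)"


section \<open>Matrices over Laurent polynomials\<close>

text \<open>Finitely supported functions from the integers to the integers with the convolution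
  product form the ring of integral Laurent polynomials; the indeterminate to the power \<open>k\<close>
  is \<open>Poly_Mapping.single k 1\<close>.\<close>

type_synonym laurent = "(int, int) poly_mapping"

text \<open>The inverse of a unit; meaningful only if \<open>f dvd 1\<close>.\<close>

definition recip :: "'a::comm_ring_1 \<Rightarrow> 'a" where
  "recip f = (THE g. f * g = 1)"

lemma recip:
  assumes "f dvd 1"
  shows "f * recip f = 1"
proof -
  obtain g where g: "f * g = 1" using assms by (metis dvdE)
  then have "h = g" if "f * h = 1" for h
    using that by (metis mult.assoc mult.commute mult_1_right)
  with g show ?thesis unfolding recip_def by (metis (mono_tags, lifting) theI)
qed

definition GL :: "nat \<Rightarrow> 'a::comm_ring_1 mat monoid" where
  "GL n = units_of (ring_mat TYPE('a) n ())"

abbreviation mat2 :: "'a \<Rightarrow> 'a \<Rightarrow> 'a \<Rightarrow> 'a \<Rightarrow> 'a mat" where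
  "mat2 a b c d \<equiv> mat_of_rows_list 2 [[a, b], [c, d]]"

definition local_mat :: "nat \<Rightarrow> nat \<Rightarrow> 'a::comm_ring_1 mat \<Rightarrow> 'a mat" where
  "local_mat n i M = diag_block_mat [1\<^sub>m (i - 1), M, 1\<^sub>m (n - i - 1)]"

definition eta2 :: "nat \<Rightarrow> laurent \<Rightarrow> nat word set \<Rightarrow> laurent mat" where
  "eta2 n f = presented_lift (GL n) (\<lambda>i. local_mat n i (mat2 0 f (recip f) 0))"

definition homogeneous_2_local :: "nat \<Rightarrow> (vst_letter word set \<Rightarrow> laurent mat) \<Rightarrow> bool" where
  "homogeneous_2_local n \<theta> \<longleftrightarrow>
    (\<exists>S\<in>carrier (GL 2). \<exists>T\<in>carrier (GL 2). \<exists>V\<in>carrier (GL 2). \<forall>i\<in>{1..<n}.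
      \<theta> (vst_gen n (Sig i)) = local_mat n i S \<and>
      \<theta> (vst_gen n (Tau i)) = local_mat n i T \<and>
      \<theta> (vst_gen n (Nu i)) = local_mat n i V)"

definition extends_eta2 :: "nat \<Rightarrow> laurent \<Rightarrow> (vst_letter word set \<Rightarrow> laurent mat) \<Rightarrow> bool" where
  "extends_eta2 n f \<theta> \<longleftrightarrow> (\<forall>i\<in>{1..<n}. \<theta> (vst_gen n (Sig i)) = eta2 n f (twin_gen n i))"

lemma group_GL: "group (GL n :: 'a::comm_ring_1 mat monoid)"
proof -
  interpret ring "ring_mat TYPE('a) n ()" by (rule ring_mat)
  show ?thesis unfolding GL_def by (rule units_group)
qed

lemma GL_simps:
  "A \<otimes>\<^bsub>GL n\<^esub> B = A * B" "\<one>\<^bsub>GL n\<^esub> = 1\<^sub>m n"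
  by (simp_all add: GL_def units_of_def ring_mat_def)

lemma carrier_GL:
  "A \<in> carrier (GL n) \<longleftrightarrow> A \<in> carrier_mat n n \<and> (\<exists>B\<in>carrier_mat n n. B * A = 1\<^sub>m n \<and> A * B = 1\<^sub>m n)"
  by (auto simp: GL_def units_of_def Units_def ring_mat_def)

lemma diag_block_mat_mult:
  assumes "list_all2 (\<lambda>A B. A \<in> carrier_mat (dim_row A) (dim_row A) \<and> B \<in> carrier_mat (dim_row A) (dim_row A)) As Bs"
  shows "diag_block_mat As * diag_block_mat Bs =
    (diag_block_mat (map2 (*) As Bs) :: 'a::comm_ring_1 mat)"
  using assms
proof (induction rule: list_all2_induct)
  case Nil
  then show ?case by (intro eq_matI) auto
next
  case (Cons A As B Bs)
  define k where "k = dim_row A"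
  then have k: "A \<in> carrier_mat k k" "B \<in> carrier_mat k k" using Cons.hyps(1) by auto
  define l where "l = sum_list (map dim_row As)"
  have "sum_list (map dim_col As) = l \<and> sum_list (map dim_row Bs) = l \<and>
      sum_list (map dim_col Bs) = l"
    using Cons.hyps(2) unfolding l_def by (induction rule: list_all2_induct) auto
  then have l: "diag_block_mat As \<in> carrier_mat l l" "diag_block_mat Bs \<in> carrier_mat l l"
    unfolding carrier_mat_def by (simp_all add: dim_diag_block_mat l_def)
  have "four_block_mat A (0\<^sub>m k l) (0\<^sub>m l k) (diag_block_mat As) *
      four_block_mat B (0\<^sub>m k l) (0\<^sub>m l k) (diag_block_mat Bs) =
      four_block_mat (A * B) (0\<^sub>m k l) (0\<^sub>m l k) (diag_block_mat As * diag_block_mat Bs)"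
    using k l by (subst mult_four_block_mat[of _ k k _ l _ l _ _ k _ l]) auto
  moreover have "dim_row (diag_block_mat As * diag_block_mat Bs) = l"
    "dim_col (diag_block_mat As * diag_block_mat Bs) = l" using l by auto
  ultimately show ?case using k l Cons.IH by (auto simp: Let_def)
qed

lemma diag_block_one:
  "diag_block_mat (1\<^sub>m a # 1\<^sub>m b # As) = (diag_block_mat (1\<^sub>m (a + b) # As) :: 'a::comm_ring_1 mat)"
  by (rule eq_matI) (auto simp: Let_def)

lemma local_mat_mult:
  assumes "A \<in> carrier_mat 2 2" "B \<in> carrier_mat 2 2"
  shows "local_mat n i A * local_mat n i B = local_mat n i (A * B :: 'a::comm_ring_1 mat)"
  using assms unfolding local_mat_def by (subst diag_block_mat_mult) auto

lemma local_mat_one: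
  "i \<in> {1..<n} \<Longrightarrow> local_mat n i (1\<^sub>m 2) = (1\<^sub>m n :: 'a::comm_ring_1 mat)"
  unfolding local_mat_def by (simp only: diag_block_one diag_block_mat_singleton) auto

lemma local_mat_carrier:
  assumes "i \<in> {1..<n}" "A \<in> carrier_mat 2 2"
  shows "local_mat n i A \<in> carrier_mat n n"
  using assms unfolding local_mat_def carrier_mat_def by (auto simp: dim_diag_block_mat Let_def)

lemma local_mat_commute_less:
  fixes A B :: "'a::comm_ring_1 mat"
  assumes "1 \<le> i" "i + 2 \<le> j" "j < n" and AB: "A \<in> carrier_mat 2 2" "B \<in> carrier_mat 2 2"
  shows "local_mat n i A * local_mat n j B = local_mat n j B * local_mat n i A"
proof -
  define a b c where a_b_c_def: "a = i - 1" "b = j - i - 2" "c = n - j - 1"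
  have e: "n - i - 1 = b + 2 + c" "j - 1 = a + 2 + b" using assms by (auto simp: a_b_c_def)
  have A: "local_mat n i A = diag_block_mat [1\<^sub>m a, A, 1\<^sub>m b, 1\<^sub>m 2, 1\<^sub>m c]"
    unfolding local_mat_def e a_b_c_def(1)[symmetric]
    by (simp only: diag_block_mat.simps(2)[of "1\<^sub>m a"] diag_block_mat.simps(2)[of A] diag_block_one)
  have B: "local_mat n j B = diag_block_mat [1\<^sub>m a, 1\<^sub>m 2, 1\<^sub>m b, B, 1\<^sub>m c]"
    unfolding local_mat_def e a_b_c_def(3)[symmetric] by (simp only: diag_block_one)
  show ?thesis
    unfolding A B using AB by (subst (1 2) diag_block_mat_mult) auto
qed

lemma mat2_involution:
  fixes f g :: "'a::comm_ring_1"
  assumes "f * g = 1"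
  shows "mat2 0 f g 0 * mat2 0 f g 0 = 1\<^sub>m 2"
  using assms by (intro eq_matI)
    (auto simp: mat_of_rows_list_def scalar_prod_def less_2_cases_iff mult.commute)

lemma
  assumes f: "f dvd 1"
  shows eta2_hom: "eta2 n f \<in> hom (twin_group n) (GL n)"
    and eta2_gen: "i \<in> {1..<n} \<Longrightarrow> eta2 n f (twin_gen n i) = local_mat n i (mat2 0 f (recip f) 0)"
proof -
  interpret G: group "GL n :: laurent mat monoid" by (rule group_GL)
  let ?M = "mat2 0 f (recip f) 0"
  let ?\<phi> = "\<lambda>i. local_mat n i ?M"
  have M: "?M \<in> carrier_mat 2 2" by (auto simp: mat_of_rows_list_def)
  have sq: "?\<phi> i * ?\<phi> i = 1\<^sub>m n" if "i \<in> {1..<n}" for i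
    using that by (simp add: local_mat_mult[OF M M] mat2_involution[OF recip[OF f]] local_mat_one)
  have \<phi>: "?\<phi> \<in> {1..<n} \<rightarrow> carrier (GL n)"
    using sq local_mat_carrier[OF _ M] by (auto simp: carrier_GL Pi_iff simp del: atLeastLessThan_iff)
  have rel: "word_val (GL n) ?\<phi> u = word_val (GL n) ?\<phi> v" if "(u, v) \<in> twin_rels n" for u v
    using that
  proof cases
    case (1 i)
    then show ?thesis using sq[of i] local_mat_carrier[OF _ M, of i n] by (auto simp: GL_simps)
  next
    case (2 i j)
    then have "i + 2 \<le> j \<or> j + 2 \<le> i" by auto
    then have "?\<phi> i * ?\<phi> j = ?\<phi> j * ?\<phi> i"
      using 2 local_mat_commute_less[OF _ _ _ M M, of i j n] local_mat_commute_less[OF _ _ _ M M, of j i n]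
      by auto
    then show ?thesis using 2 local_mat_carrier[OF _ M, of i n] local_mat_carrier[OF _ M, of j n]
      by (auto simp: GL_simps)
  qed
  show "eta2 n f \<in> hom (twin_group n) (GL n)"
    unfolding eta2_def twin_group_def by (rule G.presented_lift_hom[OF \<phi> rel])
  show "eta2 n f (twin_gen n i) = ?\<phi> i" if "i \<in> {1..<n}"
    unfolding eta2_def twin_gen_def by (rule G.presented_lift_gen[OF \<phi> rel that])
qed

end

theory Submission
  imports Defs
begin

text \<open>
  Since the blocks of the generators do not depend on the position, three relations at the
  first two positions determine the shapes of the \<open>2 \<times> 2\<close> blocks \<open>T\<close> of \<open>\<tau>\<^sub>i\<close> and \<open>V\<close> of \<open>\<nu>\<^sub>i\<close>;
  the block \<open>S\<close> of \<open>s\<^sub>i\<close> is given by the extension hypothesis.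

  The relation \<open>\<tau>\<^sub>1 s\<^sub>1 = s\<^sub>1 \<tau>\<^sub>1\<close> says that \<open>T\<close> commutes with the antidiagonal matrix \<open>S\<close>. As \<open>f\<close> is
  a unit, comparing entries gives the shape of \<open>T\<close> (\<open>commute_antidiagonal_form\<close>).

  The relation \<open>\<nu>\<^sub>1 s\<^sub>2 \<nu>\<^sub>1 = \<nu>\<^sub>2 s\<^sub>1 \<nu>\<^sub>2\<close> lives on the first three coordinates, which is where
  \<open>n \<ge> 3\<close> enters. Let \<open>a\<close> and \<open>d\<close> be the diagonal entries of \<open>V\<close>. The outer factors
  \<open>\<nu>\<^sub>2\<close> on the right fix the first coordinate, so the top left entry there is that of \<open>S\<close>, namely
  \<open>0\<close>, whereas on the left it is \<open>a\<^sup>2\<close>; symmetrically the third diagonal entry gives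
  \<open>d\<^sup>2 = 0\<close> (\<open>mixed_relation_diagonal\<close>). Laurent polynomials over the integers form a domain, so
  \<open>V\<close> is antidiagonal, and \<open>\<nu>\<^sub>1\<^sup>2 = 1\<close> makes its two remaining entries inverse to each other.
\<close>

section \<open>Relations of a presented group under a homomorphism\<close>

text \<open>The right-nested product ending in \<open>\<one>\<close> makes the relations of a presentation, which are pairs
  of positive words, unfold directly to equations between products of images of generators.\<close>

lemma hom_positive_word:
  assumes "group G" "\<theta> \<in> hom (presented_group X R) G" "set gs \<subseteq> X"
  shows "\<theta> (word_cong X R `` {pos gs}) =
    foldr (\<lambda>g a. \<theta> (presented_gen X R g) \<otimes>\<^bsub>G\<^esub> a) gs \<one>\<^bsub>G\<^esub>"
  using assms(3)
proof (induction gs)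
  case Nil
  then show ?case
    using hom_one[OF assms(2) group_presented assms(1)] by (simp add: presented_one)
next
  case (Cons g gs)
  have g: "pos [g] \<in> words X" "pos gs \<in> words X"
    using Cons.prems by (auto simp: words_def pos_def)
  have "word_cong X R `` {pos (g # gs)} =
      presented_gen X R g \<otimes>\<^bsub>presented_group X R\<^esub> word_cong X R `` {pos gs}"
    using presented_mult[OF g] unfolding presented_gen_def by simp
  then have "\<theta> (word_cong X R `` {pos (g # gs)}) =
      \<theta> (presented_gen X R g) \<otimes>\<^bsub>G\<^esub> \<theta> (word_cong X R `` {pos gs})"
    using hom_mult[OF assms(2)] presented_carrierI[OF g(1)] presented_carrierI[OF g(2)]
    unfolding presented_gen_def by metis
  then show ?case using Cons by simp
qed

lemma hom_positive_relation:
  assumes "group G" "\<theta> \<in> hom (presented_group X R) G"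
    and "(pos gs, pos hs) \<in> R" "set gs \<subseteq> X" "set hs \<subseteq> X"
  shows "foldr (\<lambda>g a. \<theta> (presented_gen X R g) \<otimes>\<^bsub>G\<^esub> a) gs \<one>\<^bsub>G\<^esub> =
    foldr (\<lambda>g a. \<theta> (presented_gen X R g) \<otimes>\<^bsub>G\<^esub> a) hs \<one>\<^bsub>G\<^esub>"
proof -
  have "pos gs \<in> words X" "pos hs \<in> words X"
    using assms(4,5) by (auto simp: words_def pos_def)
  then have "word_cong X R `` {pos gs} = word_cong X R `` {pos hs}"
    using assms(3) by (intro word_cong_class_eq word_cong.relator)
  then show ?thesis
    using hom_positive_word[OF assms(1,2,4)] hom_positive_word[OF assms(1,2,5)] by simp
qed

section \<open>Local matrices on the first coordinates\<close>

lemma local_mat_index: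
  assumes "A \<in> carrier_mat 2 2" "i \<in> {1..<n}" "r < n" "c < n"
  shows "local_mat n i A $$ (r, c) =
    (if r \<in> {i - 1, i} \<and> c \<in> {i - 1, i} then A $$ (r + 1 - i, c + 1 - i)
     else if r = c then 1 else 0)"
proof -
  obtain k where i: "i = Suc k" using assms(2) by (cases i) auto
  then obtain m where n: "n = k + (2 + m)"
    using assms(2) nat_le_iff_add[of "Suc i" n] by auto
  define D where "D = diag_block_mat [A, 1\<^sub>m m]"
  have A: "dim_row A = 2" "dim_col A = 2" using assms(1) by auto
  have D: "dim_row D = 2 + m" "dim_col D = 2 + m"
    unfolding D_def by (simp_all add: dim_diag_block_mat A)
  have D_index: "D $$ (p, q) = (if p < 2 \<and> q < 2 then A $$ (p, q) else if p = q then 1 else 0)"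
    if "p < 2 + m" "q < 2 + m" for p q
    using that unfolding D_def
    by (cases "p < 2"; cases "q < 2") (simp_all add: Let_def A, arith?)
  have split: "local_mat n i A = four_block_mat (1\<^sub>m k) (0\<^sub>m k (2 + m)) (0\<^sub>m (2 + m) k) D"
    unfolding local_mat_def i n D_def by (simp add: Let_def A)
  show ?thesis
  proof (cases "r < k \<or> c < k")
    case True
    then show ?thesis using assms(3,4) unfolding split by (auto simp: D n i)
  next
    case False
    then obtain p q where pq: "r = k + p" "c = k + q" by (metis le_iff_add not_less)
    then have "p < 2 + m" "q < 2 + m" using assms(3,4) n by simp_all
    moreover have "p < 2 \<longleftrightarrow> r \<in> {i - 1, i}" "q < 2 \<longleftrightarrow> c \<in> {i - 1, i}"
      unfolding pq i by auto
    moreover have "local_mat n i A $$ (r, c) = D $$ (p, q)"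
      using assms(3,4) unfolding split by (simp add: D n pq)
    ultimately show ?thesis by (simp add: D_index) (simp add: pq i)
  qed
qed

lemma local_mat_first_inject:
  assumes "n \<ge> 2" "A \<in> carrier_mat 2 2" "B \<in> carrier_mat 2 2"
    and eq: "local_mat n 1 A = local_mat n 1 B"
  shows "A = B"
proof (rule eq_matI)
  fix r c assume rc: "r < dim_row B" "c < dim_col B"
  then have "local_mat n 1 A $$ (r, c) = A $$ (r, c)" "local_mat n 1 B $$ (r, c) = B $$ (r, c)"
    using assms(1-3) by (auto simp: local_mat_index less_2_cases_iff)
  then show "A $$ (r, c) = B $$ (r, c)" using eq by simp
qed (use assms in auto)

text \<open>A relation between the first two positions can be checked on three coordinates: outside of
  them all matrices involved are the identity.\<close>

lemma local_mat_first_three: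
  assumes "n \<ge> 3" "i \<in> {1, 2}" "A \<in> carrier_mat 2 2"
  shows "local_mat n i A = diag_block_mat [local_mat 3 i A, 1\<^sub>m (n - 3)]"
proof -
  have d: "local_mat 3 i A \<in> carrier_mat 3 3" "local_mat n i A \<in> carrier_mat n n"
    using assms by (auto intro!: local_mat_carrier)
  show ?thesis
  proof (rule eq_matI)
    fix r c assume "r < dim_row (diag_block_mat [local_mat 3 i A, 1\<^sub>m (n - 3)])"
      "c < dim_col (diag_block_mat [local_mat 3 i A, 1\<^sub>m (n - 3)])"
    then have rc: "r < n" "c < n" using d assms(1) by (simp_all add: dim_diag_block_mat)
    have i: "i \<in> {1..<n}" "i \<in> {1..<3}" using assms by auto
    show "local_mat n i A $$ (r, c) = diag_block_mat [local_mat 3 i A, 1\<^sub>m (n - 3)] $$ (r, c)"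
      using d rc i assms(1,2)
      by (cases "r < 3"; cases "c < 3") (auto simp: Let_def local_mat_index[OF assms(3)])
  qed (use d assms(1) in \<open>simp_all add: dim_diag_block_mat\<close>)
qed

lemma local_mat_sandwich_first_three:
  fixes A B :: "'a::comm_ring_1 mat"
  assumes "n \<ge> 3" "i \<in> {1, 2}" "j \<in> {1, 2}" "A \<in> carrier_mat 2 2" "B \<in> carrier_mat 2 2"
  shows "local_mat n i A * (local_mat n j B * local_mat n i A) =
    diag_block_mat [local_mat 3 i A * (local_mat 3 j B * local_mat 3 i A), 1\<^sub>m (n - 3)]"
proof -
  have "local_mat 3 i A \<in> carrier_mat 3 3" "local_mat 3 j B \<in> carrier_mat 3 3"
    using assms by (auto intro!: local_mat_carrier)
  then show ?thesis
    using assms(4,5) unfolding local_mat_first_three[OF assms(1,2,4)] local_mat_first_three[OF assms(1,3,5)]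
    by (subst diag_block_mat_mult, force)+ simp
qed

section \<open>Conditions on the two-by-two blocks\<close>

lemma mat2_carrier: "mat2 a b c d \<in> carrier_mat 2 2"
  by (auto simp: mat_of_rows_list_def)

lemma mat2_mult:
  "mat2 a b c d * mat2 a' b' c' d' =
    mat2 (a * a' + b * c') (a * b' + b * d') (c * a' + d * c') (c * b' + d * d' :: 'a::comm_ring_1)"
  by (intro eq_matI) (auto simp: mat_of_rows_list_def scalar_prod_def less_Suc_eq numeral_2_eq_2)

lemma mat2_eq_iff: "mat2 a b c d = mat2 a' b' c' d' \<longleftrightarrow> a = a' \<and> b = b' \<and> c = c' \<and> d = d'"
proof
  assume eq: "mat2 a b c d = mat2 a' b' c' d'"
  have "mat2 a b c d $$ (r, s) = mat2 a' b' c' d' $$ (r, s)" for r s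
    using eq by simp
  from this[of 0 0] this[of 0 1] this[of 1 0] this[of 1 1]
  show "a = a' \<and> b = b' \<and> c = c' \<and> d = d'" by (simp add: mat_of_rows_list_def)
qed simp

lemma one_mat2: "1\<^sub>m 2 = mat2 1 0 0 1"
  by (intro eq_matI) (auto simp: mat_of_rows_list_def less_Suc_eq numeral_2_eq_2)

lemma mat2_cases:
  assumes "A \<in> carrier_mat 2 2"
  obtains a b c d where "A = mat2 a b c d"
proof
  show "A = mat2 (A $$ (0,0)) (A $$ (0,1)) (A $$ (1,0)) (A $$ (1,1))"
    using assms by (intro eq_matI) (auto simp: mat_of_rows_list_def less_Suc_eq numeral_2_eq_2)
qed

text \<open>Commuting with \<open>S\<close> amounts to the two equations \<open>b / f = f c\<close> and \<open>a f = f d\<close>, in which \<open>f\<close>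
  can be cancelled.\<close>

lemma commute_antidiagonal_form:
  fixes a b c d f :: "'a::comm_ring_1"
  assumes "f dvd 1"
    and eq: "mat2 a b c d * mat2 0 f (recip f) 0 = mat2 0 f (recip f) 0 * mat2 a b c d"
  shows "d = a" "b = f\<^sup>2 * c"
proof -
  have g: "f * recip f = 1" using recip[OF assms(1)] .
  from eq have bc: "b * recip f = f * c" and ad: "a * f = f * d"
    by (simp_all add: mat2_mult mat2_eq_iff)
  have "d = (f * d) * recip f" "a = (a * f) * recip f"
    using g by (simp_all add: mult_ac)
  then show "d = a" using ad by simp
  have "b = f * (b * recip f)" using g by (metis mult.left_commute mult_1_right)
  then show "b = f\<^sup>2 * c" using bc by (simp add: power2_eq_square mult_ac)
qed

lemma mult_index_3:
  assumes "A \<in> carrier_mat 3 3" "B \<in> carrier_mat 3 3" "r < 3" "c < 3"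
  shows "(A * B) $$ (r, c) =
    A $$ (r, 0) * B $$ (0, c) + A $$ (r, 1) * B $$ (1, c) + A $$ (r, 2) * B $$ (2, c)"
  using assms by (simp add: scalar_prod_def numeral_3_eq_3 numeral_2_eq_2)

text \<open>The diagonal entries at the two ends of the three coordinates suffice, because there the
  outer factors of one side act trivially and leave a zero of the diagonal of \<open>S\<close>.\<close>

lemma mixed_relation_diagonal:
  fixes a b c d f g :: "'a::comm_ring_1"
  assumes "n \<ge> 3"
    and "local_mat n 1 (mat2 a b c d) * (local_mat n 2 (mat2 0 f g 0) * local_mat n 1 (mat2 a b c d)) =
      local_mat n 2 (mat2 a b c d) * (local_mat n 1 (mat2 0 f g 0) * local_mat n 2 (mat2 a b c d))"
  shows "a * a = 0" "d * d = 0"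
proof -
  let ?V = "mat2 a b c d" and ?S = "mat2 0 f g 0"
  let ?L = "local_mat 3 1 ?V * (local_mat 3 2 ?S * local_mat 3 1 ?V)"
  let ?R = "local_mat 3 2 ?V * (local_mat 3 1 ?S * local_mat 3 2 ?V)"
  have c: "local_mat 3 i M \<in> carrier_mat 3 3" if "i \<in> {1, 2}" "M \<in> carrier_mat 2 2"
    for i and M :: "'a mat" using that by (auto intro!: local_mat_carrier)
  have eq: "diag_block_mat [?L, 1\<^sub>m (n - 3)] = diag_block_mat [?R, 1\<^sub>m (n - 3)]"
    using assms(2)
      local_mat_sandwich_first_three[OF assms(1) _ _ mat2_carrier[of a b c d] mat2_carrier[of 0 f g 0], of 1 2]
      local_mat_sandwich_first_three[OF assms(1) _ _ mat2_carrier[of a b c d] mat2_carrier[of 0 f g 0], of 2 1]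
    by (metis insertCI)
  \<comment> \<open>Equality of the \<open>n \<times> n\<close> matrices descends to the leading \<open>3 \<times> 3\<close> blocks.\<close>
  have LR: "?L $$ (r, r) = ?R $$ (r, r)" if "r < 3" for r
  proof -
    have "diag_block_mat [M, 1\<^sub>m (n - 3)] $$ (r, r) = M $$ (r, r)" if "M \<in> carrier_mat 3 3"
      for M :: "'a mat" using that \<open>r < 3\<close> by (auto simp: Let_def)
    moreover have "?L \<in> carrier_mat 3 3" "?R \<in> carrier_mat 3 3"
      by - (intro mult_carrier_mat[of _ 3 3] c mat2_carrier; simp)+
    ultimately show ?thesis using eq by metis
  qed
  have V: "local_mat 3 1 ?V \<in> carrier_mat 3 3" "local_mat 3 2 ?V \<in> carrier_mat 3 3"
    and S: "local_mat 3 1 ?S \<in> carrier_mat 3 3" "local_mat 3 2 ?S \<in> carrier_mat 3 3"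
    by - (intro c mat2_carrier; simp)+
  have entry: "mat2 p q r s $$ (0, 0) = p" "mat2 p q r s $$ (0, 1) = q"
    "mat2 p q r s $$ (1, 0) = r" "mat2 p q r s $$ (1, 1) = s" for p q r s :: 'a
    by (simp_all add: mat_of_rows_list_def)
  note index = mult_index_3[OF V(1) mult_carrier_mat[OF S(2) V(1)]] mult_index_3[OF S(2) V(1)]
    mult_index_3[OF V(2) mult_carrier_mat[OF S(1) V(2)]] mult_index_3[OF S(1) V(2)]
    local_mat_index[OF mat2_carrier]
  show "a * a = 0" "d * d = 0"
    using LR[of 0] LR[of 2] by (simp_all add: index[unfolded One_nat_def] entry[unfolded One_nat_def])
qed

lemma recip_unique: "f * g = 1 \<Longrightarrow> recip f = (g :: 'a::comm_ring_1)"
  by (metis dvd_triv_left recip mult.left_commute mult_1_right)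

section \<open>The shape of the representation\<close>

theorem theorem17:
  fixes n :: nat and f :: laurent and \<theta> :: "vst_letter word set \<Rightarrow> laurent mat"
  assumes "n \<ge> 3"
    and "f dvd 1"
    and "\<theta> \<in> hom (VST n) (GL n)"
    and "homogeneous_2_local n \<theta>"
    and "extends_eta2 n f \<theta>"
  shows "\<exists>w y v :: laurent. v dvd 1 \<and> (\<forall>i\<in>{1..<n}.
    \<theta> (vst_gen n (Sig i)) =
      diag_block_mat [1\<^sub>m (i - 1), mat2 0 f (recip f) 0, 1\<^sub>m (n - i - 1)] \<and>
    \<theta> (vst_gen n (Tau i)) =
      diag_block_mat [1\<^sub>m (i - 1), mat2 w (f\<^sup>2 * y) y w, 1\<^sub>m (n - i - 1)] \<and>
    \<theta> (vst_gen n (Nu i)) =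
      diag_block_mat [1\<^sub>m (i - 1), mat2 0 v (recip v) 0, 1\<^sub>m (n - i - 1)])"
proof -
  let ?S = "mat2 0 f (recip f) 0"
  obtain T V where TV: "T \<in> carrier (GL 2)" "V \<in> carrier (GL 2)"
    and tau: "\<And>i. i \<in> {1..<n} \<Longrightarrow> \<theta> (vst_gen n (Tau i)) = local_mat n i T"
    and nu: "\<And>i. i \<in> {1..<n} \<Longrightarrow> \<theta> (vst_gen n (Nu i)) = local_mat n i V"
    using assms(4) unfolding homogeneous_2_local_def by metis
  have T: "T \<in> carrier_mat 2 2" and V: "V \<in> carrier_mat 2 2"
    using TV by (auto simp: carrier_GL)
  have sig: "\<theta> (vst_gen n (Sig i)) = local_mat n i ?S" if "i \<in> {1..<n}" for i
    using assms(5) eta2_gen[OF assms(2)] that by (simp add: extends_eta2_def)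
  have relation: "foldr (\<lambda>g A. \<theta> (vst_gen n g) * A) gs (1\<^sub>m n) =
      foldr (\<lambda>g A. \<theta> (vst_gen n g) * A) hs (1\<^sub>m n)"
    if "(pos gs, pos hs) \<in> vst_rels n" "set gs \<subseteq> vst_letters n" "set hs \<subseteq> vst_letters n" for gs hs
    using hom_positive_relation[OF group_GL assms(3)[unfolded VST_def] that]
    by (simp add: GL_simps vst_gen_def)
  have ind: "1 \<in> {1..<n}" "2 \<in> {1..<n}" using assms(1) by auto
  have letters: "Sig i \<in> vst_letters n" "Tau i \<in> vst_letters n" "Nu i \<in> vst_letters n"
    if "i \<in> {1..<n}" for i
    using that by (auto simp: vst_letters_def)
  note letters = letters[OF ind(1)] letters[OF ind(2)]
  note vals = sig[OF ind(1)] sig[OF ind(2)] tau[OF ind(1)] nu[OF ind(1)] nu[OF ind(2)]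
  have one: "M * 1\<^sub>m n = M" if "M \<in> carrier_mat n n" for M :: "laurent mat"
    using that by simp
  have S: "?S \<in> carrier_mat 2 2" by (rule mat2_carrier)
  note one = one[OF local_mat_carrier[OF ind(1) S]] one[OF local_mat_carrier[OF ind(2) S]]
    one[OF local_mat_carrier[OF ind(1) T]]
    one[OF local_mat_carrier[OF ind(1) V]] one[OF local_mat_carrier[OF ind(2) V]]

  have "local_mat n 1 T * local_mat n 1 ?S = local_mat n 1 ?S * local_mat n 1 T"
    using relation[OF vst_rels.intros(3)[OF ind(1)]] letters
    unfolding foldr.simps o_def id_def vals one by simp
  then have TS: "T * ?S = ?S * T"
    unfolding local_mat_mult[OF T S] local_mat_mult[OF S T]
    by (rule local_mat_first_inject[rotated -1]) (use T S assms(1) in auto)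

  \<comment> \<open>The empty side of the relation has to be presented as the positive word \<open>pos []\<close>.\<close>
  have "(pos [Nu 1, Nu 1], pos []) \<in> vst_rels n"
    using vst_rels.intros(2)[OF ind(1)] by simp
  from relation[OF this] have "local_mat n 1 V * local_mat n 1 V = 1\<^sub>m n"
    using letters unfolding foldr.simps o_def id_def vals one by simp
  then have "local_mat n 1 (V * V) = local_mat n 1 (1\<^sub>m 2)"
    unfolding local_mat_mult[OF V V] local_mat_one[OF ind(1)] .
  then have VV: "V * V = 1\<^sub>m 2"
    by (rule local_mat_first_inject[rotated -1]) (use V assms(1) in auto)

  have VSV: "local_mat n 1 V * (local_mat n 2 ?S * local_mat n 1 V) =
      local_mat n 2 V * (local_mat n 1 ?S * local_mat n 2 V)"
    using relation[OF vst_rels.intros(6)[OF ind]] letters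
    unfolding foldr.simps o_def id_def vals one by simp

  obtain w x y z where T_eq: "T = mat2 w x y z" using T by (rule mat2_cases)
  obtain a v u d where V_eq: "V = mat2 a v u d" using V by (rule mat2_cases)
  have zx: "z = w" "x = f\<^sup>2 * y"
    using commute_antidiagonal_form[OF assms(2) TS[unfolded T_eq]] by auto
  \<comment> \<open>The squares of the diagonal entries vanish, and there are no zero divisors.\<close>
  have ad: "a = 0" "d = 0"
    using mixed_relation_diagonal[OF assms(1) VSV[unfolded V_eq]] by simp_all
  have "v * u = 1"
    using VV unfolding V_eq ad one_mat2 mat2_mult mat2_eq_iff by simp
  then have v: "v dvd 1" "u = recip v" by (metis dvd_triv_left, metis recip_unique)
  show ?thesis
    using v(1) sig tau nu unfolding T_eq V_eq ad zx v(2) local_mat_def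
    by (intro exI[of _ w] exI[of _ y] exI[of _ v] conjI ballI) simp_all
qed

end
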